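(* Let $n$ be a positive integer and let $k,l$ be integers with $1\le k$, $k+3\le l\le n$. Any $n\times n$ strictly upper triangular matrix of an $L_1(k,l)$-formation is CN-realizable.
   Context: $L_1(k,l)$-formation. A strictly upper triangular $n\times n$ matrix $M$ has an $L_1(k,l)$-formation if: - $M(k,j)=2$ when $j=k+1$ or $k+3\le j\le l$; - $M(k,k+2)$ is $0$ or $2$; - $M(k+1,k+3)$ is $0$ or $2$; - $M(k+2,j)=2$ when $k+3\le j\le l$; - all other entries are $0$. Braid projections. An $n$-braid projection $B$ consists of $n$ strands in the plane, each running monotonically downward from one of $n$ points on an upper horizontal bar to one of $n$ points on a lower horizontal bar, meeting each other only in finitely many transverse double points (crossings), with no over/under information. The strands are named $s_1,\dots,s_n$ from left to right at the top. Combinatorially, $B$ is encoded by a finite word with letters in $\{1,\dots,n-1\}$: reading from top to bottom, the letter $k$ means that the two strands currently in positions $k$ and $k+1$ cross once and exchange positions (no reduction is assumed). The CN matrix $N(B)$ is the symmetric zero-diagonal $n\times n$ matrix whose $(i,j)$ entry ($i\neq j$) is the number of crossings between $s_i$ and $s_j$. CN matrices are represented by strictly upper triangular matrices: a strictly upper triangular $n\times n$ matrix $M$ is CN-realizable if there is an $n$-braid projection $B$ with $M(i,j)=N(B)(i,j)$ for all $1\le i<j\le n$. *)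

theory Defs
  imports Main "HOL-Combinatorics.Transposition"
begin

text \<open>
  Matrices are functions on 1-based indices; only the entries with indices in
  \<open>{1..n}\<close> are meaningful.
\<close>

definition strictly_upper_triangular :: "nat \<Rightarrow> (nat \<Rightarrow> nat \<Rightarrow> int) \<Rightarrow> bool" where
  "strictly_upper_triangular n M \<longleftrightarrow>
     (\<forall>i \<in> {1..n}. \<forall>j \<in> {1..n}. j \<le> i \<longrightarrow> M i j = 0)"

definition L1_formation :: "nat \<Rightarrow> nat \<Rightarrow> nat \<Rightarrow> (nat \<Rightarrow> nat \<Rightarrow> int) \<Rightarrow> bool" where
  "L1_formation n k l M \<longleftrightarrow>
     (\<forall>j. j = k + 1 \<or> k + 3 \<le> j \<and> j \<le> l \<longrightarrow> M k j = 2) \<and>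
     M k (k + 2) \<in> {0, 2} \<and>
     M (k + 1) (k + 3) \<in> {0, 2} \<and>
     (\<forall>j. k + 3 \<le> j \<and> j \<le> l \<longrightarrow> M (k + 2) j = 2) \<and>
     (\<forall>i \<in> {1..n}. \<forall>j \<in> {1..n}.
        (i, j) \<notin> {(k, k + 1), (k, k + 2), (k + 1, k + 3)} \<union> {k, k + 2} \<times> {k + 3..l}
        \<longrightarrow> M i j = 0)"

definition braid_projection :: "nat \<Rightarrow> nat list \<Rightarrow> bool" where
  "braid_projection n w \<longleftrightarrow> set w \<subseteq> {1..n - 1}"

text \<open>
  \<open>strand_at w p\<close> is the name of the strand in position \<open>p\<close> after the crossings of \<open>w\<close>
  have been carried out from top to bottom; at the top, strand \<open>p\<close> is in position \<open>p\<close>.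
\<close>

definition strand_at :: "nat list \<Rightarrow> nat \<Rightarrow> nat" where
  "strand_at w = foldl (\<lambda>\<sigma> p. \<sigma> \<circ> transpose p (p + 1)) id w"

definition CN_matrix :: "nat list \<Rightarrow> nat \<Rightarrow> nat \<Rightarrow> nat" where
  "CN_matrix w i j =
     card {t. t < length w \<and>
       {strand_at (take t w) (w ! t), strand_at (take t w) (w ! t + 1)} = {i, j}}"

lemma inj_strand_at: "inj (strand_at w)"
proof (induction w rule: rev_induct)
  case Nil
  then show ?case by (simp add: strand_at_def)
next
  case (snoc p w)
  have "strand_at (w @ [p]) = strand_at w \<circ> transpose p (p + 1)"
    by (simp add: strand_at_def)
  then show ?case
    using inj_compose[OF snoc inj_transpose] by metis
qed

lemma CN_matrix_diagonal: "CN_matrix w i i = 0"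
proof -
  have "strand_at v p \<noteq> strand_at v (p + 1)" for v p
    using inj_strand_at[of v] by (simp add: inj_eq)
  then have "{strand_at v p, strand_at v (p + 1)} \<noteq> {i, i}" for v p
    by (metis insert_absorb2 insert_iff singletonD)
  then show ?thesis by (simp add: CN_matrix_def)
qed

lemma CN_matrix_symmetric: "CN_matrix w i j = CN_matrix w j i"
  by (simp add: CN_matrix_def insert_commute)

definition CN_realizable :: "nat \<Rightarrow> (nat \<Rightarrow> nat \<Rightarrow> int) \<Rightarrow> bool" where
  "CN_realizable n M \<longleftrightarrow>
     (\<exists>w. braid_projection n w \<and>
       (\<forall>i j. 1 \<le> i \<and> i < j \<and> j \<le> n \<longrightarrow> M i j = int (CN_matrix w i j)))"

end

theory Submission
  imports Defs
begin

text \<open>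
  Move strand \<open>k + 2\<close> to the right across \<open>k + 3, \<dots>, l\<close>, and then strand \<open>k\<close> across
  \<open>k + 1, k + 3, \<dots>, l\<close>. The order is now \<open>k + 1, k + 3, \<dots>, l, k, k + 2\<close>, in which both optional
  pairs \<open>(k, k + 2)\<close> and \<open>(k + 1, k + 3)\<close> are adjacent, so that each of them can be crossed twice
  on the spot if required. Undoing the first two moves doubles their crossings and adds no new pair.
\<close>

text \<open>The parameter \<open>\<sigma>\<close> is the arrangement before the word begins.
  Carrying it along lets a word be split into blocks, and listing the pairs in order lets a block be
  compared with its reversal.\<close>

fun crossings :: "(nat \<Rightarrow> nat) \<Rightarrow> nat list \<Rightarrow> nat set list" where
  "crossings \<sigma> [] = []"
| "crossings \<sigma> (p # w) = {\<sigma> p, \<sigma> (p + 1)} # crossings (\<sigma> \<circ> transpose p (p + 1)) w"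

lemma strand_at_Nil [simp]: "strand_at [] = id"
  by (simp add: strand_at_def)

lemma strand_at_snoc: "strand_at (w @ [p]) = strand_at w \<circ> transpose p (p + 1)"
  by (simp add: strand_at_def)

lemma strand_at_append: "strand_at (u @ v) = strand_at u \<circ> strand_at v"
  by (induction v rule: rev_induct)
    (simp_all add: strand_at_snoc comp_assoc flip: append_assoc)

lemma strand_at_Cons: "strand_at (p # w) = transpose p (p + 1) \<circ> strand_at w"
  using strand_at_append[of "[p]" w] strand_at_snoc[of "[]" p] by simp

lemma crossings_append:
  "crossings \<sigma> (u @ v) = crossings \<sigma> u @ crossings (\<sigma> \<circ> strand_at u) v"
  by (induction u arbitrary: \<sigma>) (simp_all add: strand_at_Cons comp_assoc)

text \<open>Induction runs from the right: the prefixes inspected for \<open>w\<close> are also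
  prefixes of \<open>w @ [p]\<close>, so only the last letter can add a crossing.\<close>

lemma CN_matrix_eq_count: "CN_matrix w i j = count_list (crossings id w) {i, j}"
proof (induction w rule: rev_induct)
  case Nil
  then show ?case by (simp add: CN_matrix_def)
next
  case (snoc p w)
  define P where "P w t \<longleftrightarrow>
    {strand_at (take t w) (w ! t), strand_at (take t w) (w ! t + 1)} = {i, j}" for w t
  have CN: "CN_matrix w i j = card {t. t < length w \<and> P w t}" for w
    by (simp add: CN_matrix_def P_def)
  have prefix: "P (w @ [p]) t = P w t" if "t < length w" for t
    using that by (simp add: P_def nth_append)
  have last: "P (w @ [p]) (length w) \<longleftrightarrow> {strand_at w p, strand_at w (p + 1)} = {i, j}"
    by (simp add: P_def)
  have "{t. t < length (w @ [p]) \<and> P (w @ [p]) t}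
    = {t. t < length w \<and> P w t} \<union> (if P (w @ [p]) (length w) then {length w} else {})"
    by (auto simp: less_Suc_eq prefix)
  then have "CN_matrix (w @ [p]) i j
      = CN_matrix w i j + (if P (w @ [p]) (length w) then 1 else 0)"
    unfolding CN by simp
  then show ?case
    unfolding snoc last by (simp add: crossings_append id_def)
qed

text \<open>Each letter acts as an involution, so \<open>rev u\<close> inverts
  \<open>u\<close>.\<close>

lemma strand_at_conjugate:
  assumes "strand_at v = id"
  shows "strand_at (u @ v @ rev u) = id"
proof (induction u)
  case Nil
  then show ?case using assms by simp
next
  case (Cons p u)
  have "strand_at ((p # u) @ v @ rev (p # u))
    = transpose p (p + 1) \<circ> strand_at (u @ v @ rev u) \<circ> transpose p (p + 1)"
    using strand_at_snoc[of "p # u @ v @ rev u" p] by (simp add: strand_at_Cons)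
  then show ?case using Cons by simp
qed

text \<open>Since \<open>v\<close> returns every strand to its place, \<open>rev u\<close> retraces
  \<open>u\<close> and meets the same unordered pairs backwards.\<close>

lemma crossings_conjugate:
  assumes "strand_at v = id"
  shows "crossings \<sigma> (u @ v @ rev u)
    = crossings \<sigma> u @ crossings (\<sigma> \<circ> strand_at u) v @ rev (crossings \<sigma> u)"
proof (induction u arbitrary: \<sigma>)
  case Nil
  then show ?case by simp
next
  case (Cons p u)
  let ?\<tau> = "\<sigma> \<circ> transpose p (p + 1)"
  have "crossings \<sigma> ((p # u) @ v @ rev (p # u))
    = {\<sigma> p, \<sigma> (p + 1)} # crossings ?\<tau> ((u @ v @ rev u) @ [p])"
    by simp
  also have "\<dots> = {\<sigma> p, \<sigma> (p + 1)} # crossings ?\<tau> (u @ v @ rev u) @ [{\<sigma> p, \<sigma> (p + 1)}]"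
    unfolding crossings_append[of _ "u @ v @ rev u"] strand_at_conjugate[OF assms]
    by (simp add: insert_commute)
  finally show ?case
    unfolding Cons by (simp add: strand_at_Cons comp_def)
qed

text \<open>The strand in position \<open>p\<close> travels right to position \<open>q\<close>, and
  each strand it passes shifts one position to the left.\<close>

lemma strand_at_upt:
  assumes "p \<le> q"
  shows "strand_at [p..<q]
    = (\<lambda>x. if x = q then p else if p \<le> x \<and> x < q then x + 1 else x)"
  using assms
proof (induction q rule: dec_induct)
  case base
  then show ?case by auto
next
  case (step q)
  then show ?case
    by (auto simp: strand_at_snoc transpose_def fun_eq_iff)
qed

text \<open>The travelling strand is always \<open>\<sigma> p\<close>; at letter \<open>t\<close> it
  meets the strand in position \<open>t + 1\<close>, which has not moved yet.\<close>

lemma crossings_upt: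
  assumes "p \<le> q"
  shows "crossings \<sigma> [p..<q] = map (\<lambda>t. {\<sigma> p, \<sigma> (t + 1)}) [p..<q]"
  using assms
proof (induction q rule: dec_induct)
  case base
  then show ?case by simp
next
  case (step q)
  then show ?case
    by (simp add: crossings_append strand_at_upt)
qed

lemma count_list_distinct:
  "distinct xs \<Longrightarrow> count_list xs x = of_bool (x \<in> set xs)"
  by (induction xs) auto

theorem proposition18:
  fixes n k l :: nat and M :: "nat \<Rightarrow> nat \<Rightarrow> int"
  assumes "1 \<le> n"
    and "1 \<le> k" and "k + 3 \<le> l" and "l \<le> n"
    and "strictly_upper_triangular n M"
    and "L1_formation n k l M"
  shows "CN_realizable n M"
proof -
  \<comment> \<open>The second block ends at position \<open>l - 1\<close>, just left of strand
    \<open>k + 2\<close> in position \<open>l\<close>, so \<open>u\<close> does not cross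
    \<open>k\<close> with \<open>k + 2\<close>.\<close>
  define u where "u = [k + 2..<l] @ [k..<l - 1]"
  \<comment> \<open>After \<open>u\<close>, positions \<open>l - 1\<close>, \<open>l\<close> hold
    \<open>k\<close>, \<open>k + 2\<close>, and positions \<open>k\<close>, \<open>k + 1\<close>
    hold \<open>k + 1\<close>, \<open>k + 3\<close>. Doubling a letter crosses its pair twice and
    restores the order.\<close>
  define v where "v = (if M k (k + 2) = 2 then [l - 1, l - 1] else [])
    @ (if M (k + 1) (k + 3) = 2 then [k, k] else [])"
  define w where "w = u @ v @ rev u"
  \<comment> \<open>These are the pairs whose entry is 2 unconditionally; \<open>u\<close> meets
    each exactly once.\<close>
  let ?S = "{{k, k + 1}} \<union> (\<lambda>j. {k, j}) ` {k + 3..l} \<union> (\<lambda>j. {k + 2, j}) ` {k + 3..l}"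
  have "braid_projection n w"
    using assms(2-4) by (auto simp: braid_projection_def w_def u_def v_def)
  have "strand_at [p, p] = id" for p
    by (simp add: strand_at_Cons)
  then have v_id: "strand_at v = id"
    by (auto simp: v_def strand_at_append)
  have u_at: "strand_at u k = k + 1" "strand_at u (k + 1) = k + 3"
      "strand_at u (l - 1) = k" "strand_at u l = k + 2"
    using assms(3) by (auto simp: u_def strand_at_append strand_at_upt)
  have "crossings id [k + 2..<l] = map (\<lambda>j. {k + 2, j}) [k + 3..<l + 1]"
  proof -
    have "[k + 3..<l + 1] = map Suc [k + 2..<l]"
      by (simp add: map_Suc_upt numeral_3_eq_3 del: upt_Suc)
    then show ?thesis
      using assms(3) by (simp add: crossings_upt del: upt_Suc)
  qed
  moreover have "crossings (strand_at [k + 2..<l]) [k..<l - 1]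
    = {k, k + 1} # map (\<lambda>j. {k, j}) [k + 3..<l + 1]"
  proof -
    \<comment> \<open>Strand \<open>k\<close> first meets \<open>k + 1\<close>, which the first
      block left in place. Strands \<open>k + 3\<close> to \<open>l\<close> have shifted left by
      one, so a later letter \<open>t\<close> meets strand \<open>t + 2\<close>; hence the separate
      head and the shift by 2.\<close>
    have "[k..<l - 1] = k # [k + 1..<l - 1]"
      using assms(3) by (simp add: upt_conv_Cons)
    moreover have "[k + 3..<l + 1] = map (\<lambda>t. t + 2) [k + 1..<l - 1]"
    proof -
      have "(\<lambda>t. t + 2) = Suc \<circ> Suc"
        by auto
      then have "map (\<lambda>t. t + 2) [k + 1..<l - 1] = [Suc (Suc (k + 1))..<Suc (Suc (l - 1))]"
        by (simp only: map_Suc_upt flip: map_map)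
      moreover have "Suc (Suc (k + 1)) = k + 3" "Suc (Suc (l - 1)) = l + 1"
        using assms(3) by auto
      ultimately show ?thesis
        by (simp only:)
    qed
    ultimately show ?thesis
      using assms(3) by (auto simp: crossings_upt strand_at_upt simp del: upt_Suc)
  qed
  ultimately have u_crossings: "crossings id u = map (\<lambda>j. {k + 2, j}) [k + 3..<l + 1]
      @ {k, k + 1} # map (\<lambda>j. {k, j}) [k + 3..<l + 1]"
    by (simp add: u_def crossings_append del: upt_Suc)
  \<comment> \<open>As no pair occurs twice in \<open>u\<close>, counting becomes membership in
    \<open>?S\<close>.\<close>
  have "distinct (crossings id u)"
  proof -
    have inj: "inj_on (\<lambda>j. {a, j}) A" for a :: nat and A
      by (auto intro: inj_onI simp: doubleton_eq_iff)
    have "{k, j} \<noteq> {k + 2, j'}" if "k + 3 \<le> j'" for j j'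
      using that by (simp add: doubleton_eq_iff)
    moreover have "{k, k + 1} \<noteq> {k, j}" if "k + 3 \<le> j" for j
      using that by (simp add: doubleton_eq_iff)
    ultimately show ?thesis
      unfolding u_crossings distinct_append distinct.simps distinct_map set_map set_upt list.set
      using inj distinct_upt by fastforce
  qed
  moreover have "set (crossings id u) = ?S"
    unfolding u_crossings set_append list.set set_map set_upt
    by (simp only: atLeastLessThanSuc_atLeastAtMost Suc_eq_plus1[symmetric]) blast
  ultimately have u_count: "count_list (crossings id u) e = of_bool (e \<in> ?S)" for e
    by (simp only: count_list_distinct)
  have v_crossings: "crossings (strand_at u) v
    = (if M k (k + 2) = 2 then [{k, k + 2}, {k, k + 2}] else [])
      @ (if M (k + 1) (k + 3) = 2 then [{k + 1, k + 3}, {k + 1, k + 3}] else [])"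
    using u_at assms(3)
    by (auto simp: v_def insert_commute)
  \<comment> \<open>The first factor 2 comes from \<open>u\<close> and \<open>rev u\<close>, the
    other two from the doubled letters of \<open>v\<close>.\<close>
  have w_count: "count_list (crossings id w) e = 2 * of_bool (e \<in> ?S)
      + 2 * of_bool (M k (k + 2) = 2 \<and> e = {k, k + 2})
      + 2 * of_bool (M (k + 1) (k + 3) = 2 \<and> e = {k + 1, k + 3})" for e
    unfolding w_def crossings_conjugate[OF v_id] count_list_append count_list_rev u_count
    using v_crossings by auto
  have "M i j = int (CN_matrix w i j)" if "1 \<le> i" "i < j" "j \<le> n" for i j
  proof -
    \<comment> \<open>Crossings are unordered pairs; since \<open>i < j\<close> and \<open>a\<close>
      lies below \<open>k + 3\<close>, the smaller element must be \<open>a\<close>. This serves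
      \<open>a = k\<close> and \<open>a = k + 2\<close>.\<close>
    have image: "{i, j} \<in> (\<lambda>j. {a, j}) ` {k + 3..l} \<longleftrightarrow> i = a \<and> j \<in> {k + 3..l}"
      if "a < k + 3" for a
    proof
      assume "{i, j} \<in> (\<lambda>j. {a, j}) ` {k + 3..l}"
      then obtain j' where "{i, j} = {a, j'}" "j' \<in> {k + 3..l}"
        by (rule imageE)
      moreover from this that have "a < j'"
        by simp
      ultimately show "i = a \<and> j \<in> {k + 3..l}"
        using \<open>i < j\<close> by (metis doubleton_eq_iff less_asym)
    qed simp
    have pair: "{i, j} = {a, b} \<longleftrightarrow> i = a \<and> j = b" if "a < b" for a b
      using that \<open>i < j\<close> by (metis doubleton_eq_iff less_asym)
    have count: "CN_matrix w i j
      = 2 * of_bool (i = k \<and> j = k + 1 \<or> (i = k \<or> i = k + 2) \<and> k + 3 \<le> j \<and> j \<le> l)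
      + 2 * of_bool (M k (k + 2) = 2 \<and> i = k \<and> j = k + 2)
      + 2 * of_bool (M (k + 1) (k + 3) = 2 \<and> i = k + 1 \<and> j = k + 3)"
      unfolding CN_matrix_eq_count w_count by (simp add: image pair)
    have entries: "M k (k + 1) = 2" "M k (k + 2) \<in> {0, 2}" "M (k + 1) (k + 3) \<in> {0, 2}"
        "k + 3 \<le> j \<Longrightarrow> j \<le> l \<Longrightarrow> M k j = 2" "k + 3 \<le> j \<Longrightarrow> j \<le> l \<Longrightarrow> M (k + 2) j = 2"
      using assms(6) by (simp_all add: L1_formation_def)
    consider "(i, j) = (k, k + 1)" | "(i, j) = (k, k + 2)" | "(i, j) = (k + 1, k + 3)"
      | "i = k" "k + 3 \<le> j" "j \<le> l" | "i = k + 2" "k + 3 \<le> j" "j \<le> l"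
      | "(i, j) \<notin> {(k, k + 1), (k, k + 2), (k + 1, k + 3)} \<union> {k, k + 2} \<times> {k + 3..l}"
      by auto
    then show ?thesis
    proof cases
      case 6
      moreover have "i \<in> {1..n}" "j \<in> {1..n}"
        using that by auto
      moreover have "\<forall>i \<in> {1..n}. \<forall>j \<in> {1..n}.
          (i, j) \<notin> {(k, k + 1), (k, k + 2), (k + 1, k + 3)} \<union> {k, k + 2} \<times> {k + 3..l}
          \<longrightarrow> M i j = 0"
        using assms(6) unfolding L1_formation_def by (elim conjE)
      ultimately have "M i j = 0"
        by metis
      moreover have "CN_matrix w i j = 0"
        using 6 unfolding count by auto
      ultimately show ?thesis
        by simp
    qed (unfold count, use entries in auto)
  qed
  with \<open>braid_projection n w\<close> show ?thesis
    unfolding CN_realizable_def by blast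
qed

end
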